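(* Let $(\mathcal{B}_1,\mathcal{B}_2,\mathcal{B}_3)$ be a tripartition of $[0,1]^n$, and let $\mathcal{I}_1=\mathcal{B}_1$, $\mathcal{I}_2=\mathcal{B}_2$, $\mathcal{I}_3=\mathcal{B}_1\cup\mathcal{B}_3$, $\mathcal{I}_4=\mathcal{B}_2\cup\mathcal{B}_3$, $\mathcal{I}_5=\mathcal{B}_1\cup\mathcal{B}_2$, and $\mathcal{I}_6=\mathcal{B}_3$. Then, for any sequence $\mathcal{F}$ of $n$ conditional events, the tuple $(s_1,s_2,s_3,s_4,s_5,s_6)$ of sentences $s_k:(\mathcal{F},\mathcal{I}_k)$, $k=1,\ldots,6$, is a hexagon of opposition.
   Context: Events are two-valued logical entities (they can be modelled as subsets of a nonempty set $\Omega$ of possible cases); an event is identified with its indicator in $\{0,1\}$. A conditional event $E|H$ is given by events $E,H$ with $H\neq\bot$ (impossible event). Given $\mathcal{F}=(E_1|H_1,\ldots,E_n|H_n)$, a precise assessment on $\mathcal{F}$ is a vector $\mathcal{P}=(p_1,\ldots,p_n)$, $p_i=p(E_i|H_i)$. It is coherent iff for every nonempty subfamily, indexed by $J\subseteq\{1,\ldots,n\}$, and all real numbers $s_j$ ($j\in J$), the random gain $\mathcal{G}=\sum_{j\in J}s_jH_j(E_j-p_j)$ satisfies $\min G\le 0\le\max G$, where $G$ is the set of values of $\mathcal{G}$ restricted to $\bigvee_{j\in J}H_j$ being true. $\Pi$ denotes the set of all coherent precise assessments on $\mathcal{F}$; it is known that $\emptyset\neq\Pi\subseteq[0,1]^n$.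 For $\mathcal{I}\subseteq[0,1]^n$ write $\pi(\mathcal{I})=\Pi\cap\mathcal{I}$. A sentence is a pair $s:(\mathcal{F},\mathcal{I})$ with $\mathcal{I}\subseteq[0,1]^n$ (possibly empty). Operations: $s_1\wedge s_2:(\mathcal{F},\mathcal{I}_1\cap\mathcal{I}_2)$, $s_1\vee s_2:(\mathcal{F},\mathcal{I}_1\cup\mathcal{I}_2)$. Sentences $s:(\mathcal{F},\mathcal{I})$ and $s':(\mathcal{F},\mathcal{I}')$ are equivalent under t-coherence, $s\equiv s'$, iff $\pi(\mathcal{I})=\pi(\mathcal{I}')$. A quadruple $(s_1,s_2,s_3,s_4)$ of sentences $s_k:(\mathcal{F},\mathcal{I}_k)$ is a square of opposition iff: (a) (contraries) $\pi(\mathcal{I}_1)\cap\pi(\mathcal{I}_2)=\emptyset$; (b) (subcontraries) $\pi(\mathcal{I}_3)\cup\pi(\mathcal{I}_4)=\Pi$; (c) (contradictories) $\pi(\mathcal{I}_1)\cap\pi(\mathcal{I}_4)=\emptyset$, $\pi(\mathcal{I}_1)\cup\pi(\mathcal{I}_4)=\Pi$, $\pi(\mathcal{I}_2)\cap\pi(\mathcal{I}_3)=\emptyset$, $\pi(\mathcal{I}_2)\cup\pi(\mathcal{I}_3)=\Pi$; (d) (subalterns) $\pi(\mathcal{I}_1)\subseteq\pi(\mathcal{I}_3)$ and $\pi(\mathcal{I}_2)\subseteq\pi(\mathcal{I}_4)$. A tuple $(s_1,\ldots,s_6)$ of sentences on $\mathcal{F}$ is a hexagon of opposition iff $(s_1,s_2,s_3,s_4)$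 is a square of opposition, $s_5\equiv s_1\vee s_2$, and $s_6\equiv s_3\wedge s_4$. A tripartition of a set $S$ is an ordered triple of (possibly empty) pairwise disjoint subsets of $S$ whose union is $S$. *)

theory Defs
  imports "HOL-Analysis.Analysis"
begin

text \<open>
  Events are sets of possible cases: the (arbitrary, nonempty) type \<open>'w\<close> plays the role of
  \<open>\<Omega>\<close>. The pair \<open>(E, H)\<close> with \<open>H \<noteq> {}\<close> stands for the conditional event \<open>E|H\<close>.
  A sequence of \<open>n\<close> conditional events is a vector over a finite index type \<open>'n\<close> with
  \<open>n = CARD('n)\<close>.
\<close>

type_synonym 'w cond_event = "'w set \<times> 'w set"

definition is_cond_event :: "'w cond_event \<Rightarrow> bool" where
  "is_cond_event c \<longleftrightarrow> snd c \<noteq> {}"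

definition cond_family :: "'w cond_event ^ 'n \<Rightarrow> bool" where
  "cond_family F \<longleftrightarrow> (\<forall>i. is_cond_event (F $ i))"

definition unit_cube :: "(real ^ 'n) set" where
  "unit_cube = {p. \<forall>i. p $ i \<in> {0..1}}"

definition gain ::
    "'w cond_event ^ 'n \<Rightarrow> real ^ 'n \<Rightarrow> 'n set \<Rightarrow> ('n \<Rightarrow> real) \<Rightarrow> 'w \<Rightarrow> real" where
  "gain F p J s \<omega> =
     (\<Sum>j\<in>J. s j * indicator (snd (F $ j)) \<omega> * (indicator (fst (F $ j)) \<omega> - p $ j))"

definition gain_values ::
    "'w cond_event ^ 'n \<Rightarrow> real ^ 'n \<Rightarrow> 'n set \<Rightarrow> ('n \<Rightarrow> real) \<Rightarrow> real set" where
  "gain_values F p J s = gain F p J s ` (\<Union>j\<in>J. snd (F $ j))"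

text \<open>
  For nonempty \<open>J\<close> and genuine conditional events, \<open>gain_values F p J s\<close> is nonempty, and it is
  finite even when \<open>'w\<close> is infinite (the gain depends only on finitely many indicators), so
  \<open>Min\<close> and \<open>Max\<close> are meaningful. Assessments range over all real vectors; that
  coherent ones lie in the unit cube is a consequence of the definition.
\<close>

definition coherent :: "'w cond_event ^ 'n::finite \<Rightarrow> real ^ 'n \<Rightarrow> bool" where
  "coherent F p \<longleftrightarrow>
     (\<forall>J s. J \<noteq> {} \<longrightarrow>
        Min (gain_values F p J s) \<le> 0 \<and> 0 \<le> Max (gain_values F p J s))"

definition coherent_set :: "'w cond_event ^ 'n::finite \<Rightarrow> (real ^ 'n) set" where
  "coherent_set F = {p. coherent F p}"

definition coherent_part ::
    "'w cond_event ^ 'n::finite \<Rightarrow> (real ^ 'n) set \<Rightarrow> (real ^ 'n) set" where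
  "coherent_part F I = coherent_set F \<inter> I"

type_synonym ('w, 'n) sentence = "('w cond_event ^ 'n) \<times> (real ^ 'n) set"

definition sentence_on :: "'w cond_event ^ 'n \<Rightarrow> ('w, 'n) sentence \<Rightarrow> bool" where
  "sentence_on F s \<longleftrightarrow> cond_family F \<and> fst s = F \<and> snd s \<subseteq> unit_cube"

text \<open>The next three notions are only used for sentences on the same family.\<close>

definition sentence_and ::
    "('w, 'n) sentence \<Rightarrow> ('w, 'n) sentence \<Rightarrow> ('w, 'n) sentence" where
  "sentence_and s s' = (fst s, snd s \<inter> snd s')"

definition sentence_or ::
    "('w, 'n) sentence \<Rightarrow> ('w, 'n) sentence \<Rightarrow> ('w, 'n) sentence" where
  "sentence_or s s' = (fst s, snd s \<union> snd s')"

definition t_equiv :: "('w, 'n::finite) sentence \<Rightarrow> ('w, 'n) sentence \<Rightarrow> bool" where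
  "t_equiv s s' \<longleftrightarrow>
     fst s = fst s' \<and> coherent_part (fst s) (snd s) = coherent_part (fst s') (snd s')"

definition contraries ::
    "'w cond_event ^ 'n::finite \<Rightarrow> ('w, 'n) sentence \<Rightarrow> ('w, 'n) sentence \<Rightarrow> bool" where
  "contraries F s s' \<longleftrightarrow> coherent_part F (snd s) \<inter> coherent_part F (snd s') = {}"

definition subcontraries ::
    "'w cond_event ^ 'n::finite \<Rightarrow> ('w, 'n) sentence \<Rightarrow> ('w, 'n) sentence \<Rightarrow> bool" where
  "subcontraries F s s' \<longleftrightarrow>
     coherent_part F (snd s) \<union> coherent_part F (snd s') = coherent_set F"

definition contradictories ::
    "'w cond_event ^ 'n::finite \<Rightarrow> ('w, 'n) sentence \<Rightarrow> ('w, 'n) sentence \<Rightarrow> bool" where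
  "contradictories F s s' \<longleftrightarrow>
     coherent_part F (snd s) \<inter> coherent_part F (snd s') = {} \<and>
     coherent_part F (snd s) \<union> coherent_part F (snd s') = coherent_set F"

definition subaltern ::
    "'w cond_event ^ 'n::finite \<Rightarrow> ('w, 'n) sentence \<Rightarrow> ('w, 'n) sentence \<Rightarrow> bool" where
  "subaltern F s s' \<longleftrightarrow> coherent_part F (snd s) \<subseteq> coherent_part F (snd s')"

definition square_of_opposition ::
    "'w cond_event ^ 'n::finite \<Rightarrow> ('w, 'n) sentence \<Rightarrow> ('w, 'n) sentence \<Rightarrow>
     ('w, 'n) sentence \<Rightarrow> ('w, 'n) sentence \<Rightarrow> bool" where
  "square_of_opposition F s1 s2 s3 s4 \<longleftrightarrow>
     sentence_on F s1 \<and> sentence_on F s2 \<and> sentence_on F s3 \<and> sentence_on F s4 \<and>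
     contraries F s1 s2 \<and>
     subcontraries F s3 s4 \<and>
     contradictories F s1 s4 \<and> contradictories F s2 s3 \<and>
     subaltern F s1 s3 \<and> subaltern F s2 s4"

definition hexagon_of_opposition ::
    "'w cond_event ^ 'n::finite \<Rightarrow> ('w, 'n) sentence \<Rightarrow> ('w, 'n) sentence \<Rightarrow>
     ('w, 'n) sentence \<Rightarrow> ('w, 'n) sentence \<Rightarrow> ('w, 'n) sentence \<Rightarrow>
     ('w, 'n) sentence \<Rightarrow> bool" where
  "hexagon_of_opposition F s1 s2 s3 s4 s5 s6 \<longleftrightarrow>
     square_of_opposition F s1 s2 s3 s4 \<and>
     sentence_on F s5 \<and> sentence_on F s6 \<and>
     t_equiv s5 (sentence_or s1 s2) \<and>
     t_equiv s6 (sentence_and s3 s4)"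

definition tripartition :: "'a set \<Rightarrow> 'a set \<Rightarrow> 'a set \<Rightarrow> 'a set \<Rightarrow> bool" where
  "tripartition S B1 B2 B3 \<longleftrightarrow>
     B1 \<inter> B2 = {} \<and> B1 \<inter> B3 = {} \<and> B2 \<inter> B3 = {} \<and> B1 \<union> B2 \<union> B3 = S"

end

theory Submission
  imports Defs
begin

text \<open>
  The idea is that intersecting with the set of coherent assessments turns a tripartition of the
  unit cube into a tripartition of the coherent assessments, after which every clause of the
  hexagon is Boolean algebra of sets. The one place where coherence matters is that the three
  blocks must exhaust the coherent assessments, that is, that every coherent assessment lies in
  the unit cube (\<open>coherent_set_subset_unit_cube\<close>). This is seen by betting on one conditional
  event at a time.
\<close>

lemma gain_values_singleton_subset:
  fixes F :: "'w cond_event ^ 'n::finite"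
  shows "gain_values F p {i} (\<lambda>_. 1) \<subseteq> {- p $ i, 1 - p $ i}"
  by (auto simp: gain_values_def gain_def indicator_def)

text \<open>
  The least gain is at least \<open>- p\<close> and the greatest is at most \<open>1 - p\<close>, so the two halves of
  coherence give \<open>0 \<le> p\<close> and \<open>p \<le> 1\<close> respectively. The conditioning events must be possible for
  these extrema to be attained gains.
\<close>

lemma coherent_set_subset_unit_cube:
  fixes F :: "'w cond_event ^ 'n::finite"
  assumes "cond_family F"
  shows "coherent_set F \<subseteq> unit_cube"
proof
  fix p :: "real ^ 'n"
  assume "p \<in> coherent_set F"
  have "p $ i \<in> {0..1}" for i
  proof -
    let ?G = "gain_values F p {i} (\<lambda>_. 1)"
    have G: "?G \<subseteq> {- p $ i, 1 - p $ i}"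
      by (rule gain_values_singleton_subset)
    then have "finite ?G"
      by (rule finite_subset) simp
    moreover have "?G \<noteq> {}"
      using assms by (simp add: gain_values_def cond_family_def is_cond_event_def)
    ultimately have "Min ?G \<in> ?G" "Max ?G \<in> ?G"
      by simp_all
    moreover have "Min ?G \<le> 0" "0 \<le> Max ?G"
      using \<open>p \<in> coherent_set F\<close> by (simp_all add: coherent_set_def coherent_def)
    ultimately show ?thesis
      using G by fastforce
  qed
  then show "p \<in> unit_cube"
    by (simp add: unit_cube_def)
qed

theorem mainTheorem6:
  fixes B1 B2 B3 I1 I2 I3 I4 I5 I6 :: "(real ^ 'n::finite) set"
    and F :: "'w cond_event ^ 'n"
  assumes "tripartition unit_cube B1 B2 B3"
    and "I1 = B1" and "I2 = B2" and "I3 = B1 \<union> B3"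
    and "I4 = B2 \<union> B3" and "I5 = B1 \<union> B2" and "I6 = B3"
    and "cond_family F"
  shows "hexagon_of_opposition F (F, I1) (F, I2) (F, I3) (F, I4) (F, I5) (F, I6)"
proof -
  have disj: "B1 \<inter> B2 = {}" "B1 \<inter> B3 = {}" "B2 \<inter> B3 = {}"
    and cover: "B1 \<union> B2 \<union> B3 = unit_cube"
    using assms(1) by (simp_all add: tripartition_def)
  have "coherent_set F \<subseteq> B1 \<union> B2 \<union> B3"
    using coherent_set_subset_unit_cube[OF \<open>cond_family F\<close>] cover by simp
  then have "square_of_opposition F (F, I1) (F, I2) (F, I3) (F, I4)"
    using disj cover \<open>cond_family F\<close> unfolding assms(2-5)
    by (auto simp: square_of_opposition_def sentence_on_def contraries_def subcontraries_def
        contradictories_def subaltern_def coherent_part_def)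
  moreover have "sentence_on F (F, I5)" "sentence_on F (F, I6)"
    using cover \<open>cond_family F\<close> unfolding assms(6,7) by (auto simp: sentence_on_def)
  moreover have "t_equiv (F, I5) (sentence_or (F, I1) (F, I2))"
    unfolding assms(2,3,6) by (simp add: t_equiv_def sentence_or_def)
  moreover have "I3 \<inter> I4 = I6"
    using disj unfolding assms(4,5,7) by blast
  then have "t_equiv (F, I6) (sentence_and (F, I3) (F, I4))"
    by (simp add: t_equiv_def sentence_and_def)
  ultimately show ?thesis
    by (simp add: hexagon_of_opposition_def)
qed

end
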